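(* Let $H$ be a group and $\Omega(H) = \bigl((S,1_S,\ast),\triangleleft,\triangleright,f\bigr)$ a group extending structure of $H$. Then: (1) $(H\ltimes_\Omega S,\,(i_H,i_S))$ is an initial object of the category ${}_{\Omega(H)}\mathcal{C}$, where $i_H : H\to H\ltimes_\Omega S$, $i_H(h) = (h,1_S)$, and $i_S : S\to H\ltimes_\Omega S$, $i_S(s) = (1_H,s)$, are the canonical inclusions; (2) $(H\ltimes_\Omega S,\,(\pi_H,\pi_S))$ is a final object of the category $\mathcal{D}_{\Omega(H)}$, where $\pi_H : H\ltimes_\Omega S\to H$, $\pi_H(h,s)=h$, and $\pi_S : H\ltimes_\Omega S\to S$, $\pi_S(h,s)=s$, are the canonical projections.
   Context: Let $H$ be a group with unit $1_H$. An extending datum of $H$ is a system $\Omega(H) = \bigl((S,1_S,\ast),\triangleleft,\triangleright,f\bigr)$ where $(S,1_S)$ is a pointed set (a nonempty set $S$ with a fixed element $1_S\in S$), and $\ast : S\times S\to S$, $\triangleleft : S\times H\to S$, $\triangleright : S\times H\to H$, $f : S\times S\to H$ are maps such that for all $s\in S$, $h\in H$: $s\ast 1_S = 1_S\ast s = s$, $s\triangleleft 1_H = s$, $1_S\triangleleft h = 1_S$, $1_S\triangleright h = h$, $s\triangleright 1_H = 1_H$, $f(s,1_S) = f(1_S,s) = 1_H$. For an extending datum $\Omega(H)$, $H\ltimes_\Omega S$ denotes the set $H\times S$ with the binary operation $$(h_1,s_1)\cdot(h_2,s_2) := \bigl(h_1(s_1\triangleright h_2)f(s_1\triangleleft h_2,s_2),\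 (s_1\triangleleft h_2)\ast s_2\bigr).$$ $\Omega(H)$ is called a group extending structure of $H$ if $H\ltimes_\Omega S$ is a group with this multiplication; $H\ltimes_\Omega S$ is then called the unified product. The category ${}_{\Omega(H)}\mathcal{C}$: objects are pairs $(G,(u,v))$, where $G$ is a group, $u : H\to G$ is a morphism of groups and $v : S\to G$ is a map such that for all $s,s_1,s_2\in S$, $h\in H$: $$v(s_1)v(s_2) = u(f(s_1,s_2))\,v(s_1\ast s_2),\qquad v(s)u(h) = u(s\triangleright h)\,v(s\triangleleft h).$$ A morphism $(G_1,(u_1,v_1))\to(G_2,(u_2,v_2))$ is a morphism of groups $g : G_1\to G_2$ such that $g\circ u_1 = u_2$ and $g\circ v_1 = v_2$. The category $\mathcal{D}_{\Omega(H)}$: objects are pairs $(G,(u,v))$, where $G$ is a group and $u : G\to H$, $v : G\to S$ are maps such that for all $x,y\in G$: $$u(xy) = u(x)\,[v(x)\triangleright u(y)]\,f\bigl(v(x)\triangleleft u(y),\, v(y)\bigr),\qquad v(xy) = [v(x)\triangleleft u(y)]\ast v(y).$$ A morphism $(G_1,(u_1,v_1))\to(G_2,(u_2,v_2))$ is a morphism of groups $g : G_1\to G_2$ such that $u_2\circ g = u_1$ and $v_2\circ g = v_1$. *)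

theory Defs
  imports "HOL-Algebra.Group"
begin

text \<open>
  The pointed set \<open>(S, 1\<^sub>S, \<ast>)\<close> is carried by the inherited monoid fields
  (\<open>S = carrier \<Omega>\<close>, \<open>1\<^sub>S = \<one>\<^bsub>\<Omega>\<^esub>\<close>, \<open>\<ast> = \<otimes>\<^bsub>\<Omega>\<^esub>\<close>); the record type
  imposes no monoid laws, in particular \<open>\<ast>\<close> need not be associative.
\<close>

record ('h, 's) ext_system = "'s monoid" +
  lact :: "'s \<Rightarrow> 'h \<Rightarrow> 's"  (infixl "\<triangleleft>\<index>" 75)
  ract :: "'s \<Rightarrow> 'h \<Rightarrow> 'h"  (infixr "\<triangleright>\<index>" 75)
  cocycle :: "'s \<Rightarrow> 's \<Rightarrow> 'h"

locale extending_datum =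
  group H for H :: "('h, 'm) monoid_scheme" (structure) +
  fixes \<Omega> :: "('h, 's) ext_system"
  assumes base_closed: "\<one>\<^bsub>\<Omega>\<^esub> \<in> carrier \<Omega>"
    and star_closed: "\<lbrakk>s \<in> carrier \<Omega>; t \<in> carrier \<Omega>\<rbrakk> \<Longrightarrow> s \<otimes>\<^bsub>\<Omega>\<^esub> t \<in> carrier \<Omega>"
    and lact_closed: "\<lbrakk>s \<in> carrier \<Omega>; h \<in> carrier H\<rbrakk> \<Longrightarrow> s \<triangleleft>\<^bsub>\<Omega>\<^esub> h \<in> carrier \<Omega>"
    and ract_closed: "\<lbrakk>s \<in> carrier \<Omega>; h \<in> carrier H\<rbrakk> \<Longrightarrow> s \<triangleright>\<^bsub>\<Omega>\<^esub> h \<in> carrier H"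
    and cocycle_closed: "\<lbrakk>s \<in> carrier \<Omega>; t \<in> carrier \<Omega>\<rbrakk> \<Longrightarrow> cocycle \<Omega> s t \<in> carrier H"
    and star_base: "s \<in> carrier \<Omega> \<Longrightarrow> s \<otimes>\<^bsub>\<Omega>\<^esub> \<one>\<^bsub>\<Omega>\<^esub> = s"
    and base_star: "s \<in> carrier \<Omega> \<Longrightarrow> \<one>\<^bsub>\<Omega>\<^esub> \<otimes>\<^bsub>\<Omega>\<^esub> s = s"
    and lact_one: "s \<in> carrier \<Omega> \<Longrightarrow> s \<triangleleft>\<^bsub>\<Omega>\<^esub> \<one> = s"
    and base_lact: "h \<in> carrier H \<Longrightarrow> \<one>\<^bsub>\<Omega>\<^esub> \<triangleleft>\<^bsub>\<Omega>\<^esub> h = \<one>\<^bsub>\<Omega>\<^esub>"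
    and base_ract: "h \<in> carrier H \<Longrightarrow> \<one>\<^bsub>\<Omega>\<^esub> \<triangleright>\<^bsub>\<Omega>\<^esub> h = h"
    and ract_one: "s \<in> carrier \<Omega> \<Longrightarrow> s \<triangleright>\<^bsub>\<Omega>\<^esub> \<one> = \<one>"
    and cocycle_base: "s \<in> carrier \<Omega> \<Longrightarrow> cocycle \<Omega> s \<one>\<^bsub>\<Omega>\<^esub> = \<one>"
    and base_cocycle: "s \<in> carrier \<Omega> \<Longrightarrow> cocycle \<Omega> \<one>\<^bsub>\<Omega>\<^esub> s = \<one>"

text \<open>
  The paper only specifies the multiplication of the unified product.  The HOL-Algebra record
  also needs a unit; by the normalisation axioms \<open>(1\<^sub>H, 1\<^sub>S)\<close> is always two-sided neutral
  (lemmas below), so it is the only possible choice.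
\<close>

definition unified_product ::
    "('h, 'm) monoid_scheme \<Rightarrow> ('h, 's) ext_system \<Rightarrow> ('h \<times> 's) monoid" where
  "unified_product H \<Omega> =
     \<lparr>carrier = carrier H \<times> carrier \<Omega>,
      mult = (\<lambda>(h\<^sub>1, s\<^sub>1) (h\<^sub>2, s\<^sub>2).
        (h\<^sub>1 \<otimes>\<^bsub>H\<^esub> (s\<^sub>1 \<triangleright>\<^bsub>\<Omega>\<^esub> h\<^sub>2) \<otimes>\<^bsub>H\<^esub> cocycle \<Omega> (s\<^sub>1 \<triangleleft>\<^bsub>\<Omega>\<^esub> h\<^sub>2) s\<^sub>2,
         (s\<^sub>1 \<triangleleft>\<^bsub>\<Omega>\<^esub> h\<^sub>2) \<otimes>\<^bsub>\<Omega>\<^esub> s\<^sub>2)),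
      one = (\<one>\<^bsub>H\<^esub>, \<one>\<^bsub>\<Omega>\<^esub>)\<rparr>"

lemma (in extending_datum) unified_product_one_left:
  "x \<in> carrier (unified_product H \<Omega>) \<Longrightarrow>
    \<one>\<^bsub>unified_product H \<Omega>\<^esub> \<otimes>\<^bsub>unified_product H \<Omega>\<^esub> x = x"
  by (auto simp: unified_product_def base_lact base_ract base_star base_cocycle)

lemma (in extending_datum) unified_product_one_right:
  "x \<in> carrier (unified_product H \<Omega>) \<Longrightarrow>
    x \<otimes>\<^bsub>unified_product H \<Omega>\<^esub> \<one>\<^bsub>unified_product H \<Omega>\<^esub> = x"
  by (auto simp: unified_product_def lact_one ract_one star_base cocycle_base)

locale group_extending_structure = extending_datum +
  assumes unified_product_group: "group (unified_product H \<Omega>)"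

text \<open>
  Objects are triples \<open>(G, u, v)\<close>.  Only the values of \<open>u\<close>, \<open>v\<close> on the carriers matter.  Arrows
  are normalised to be extensional, so that \<open>\<exists>!\<close> expresses uniqueness as a map on the carrier.
\<close>

type_synonym ('h, 's, 'g) C_triple = "'g monoid \<times> ('h \<Rightarrow> 'g) \<times> ('s \<Rightarrow> 'g)"
type_synonym ('h, 's, 'g) D_triple = "'g monoid \<times> ('g \<Rightarrow> 'h) \<times> ('g \<Rightarrow> 's)"

definition C_obj ::
    "('h, 'm) monoid_scheme \<Rightarrow> ('h, 's) ext_system \<Rightarrow> ('h, 's, 'g) C_triple set" where
  "C_obj H \<Omega> = {(G, u, v). group G \<and> u \<in> hom H G \<and> v \<in> carrier \<Omega> \<rightarrow> carrier G \<and>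
     (\<forall>s\<^sub>1\<in>carrier \<Omega>. \<forall>s\<^sub>2\<in>carrier \<Omega>.
        v s\<^sub>1 \<otimes>\<^bsub>G\<^esub> v s\<^sub>2 = u (cocycle \<Omega> s\<^sub>1 s\<^sub>2) \<otimes>\<^bsub>G\<^esub> v (s\<^sub>1 \<otimes>\<^bsub>\<Omega>\<^esub> s\<^sub>2)) \<and>
     (\<forall>s\<in>carrier \<Omega>. \<forall>h\<in>carrier H.
        v s \<otimes>\<^bsub>G\<^esub> u h = u (s \<triangleright>\<^bsub>\<Omega>\<^esub> h) \<otimes>\<^bsub>G\<^esub> v (s \<triangleleft>\<^bsub>\<Omega>\<^esub> h))}"

definition C_hom ::
    "('h, 'm) monoid_scheme \<Rightarrow> ('h, 's) ext_system \<Rightarrow>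
     ('h, 's, 'a) C_triple \<Rightarrow> ('h, 's, 'b) C_triple \<Rightarrow> ('a \<Rightarrow> 'b) set" where
  "C_hom H \<Omega> = (\<lambda>(G\<^sub>1, u\<^sub>1, v\<^sub>1) (G\<^sub>2, u\<^sub>2, v\<^sub>2).
     {g \<in> hom G\<^sub>1 G\<^sub>2 \<inter> extensional (carrier G\<^sub>1).
        (\<forall>h\<in>carrier H. g (u\<^sub>1 h) = u\<^sub>2 h) \<and> (\<forall>s\<in>carrier \<Omega>. g (v\<^sub>1 s) = v\<^sub>2 s)})"

definition D_obj ::
    "('h, 'm) monoid_scheme \<Rightarrow> ('h, 's) ext_system \<Rightarrow> ('h, 's, 'g) D_triple set" where
  "D_obj H \<Omega> = {(G, u, v). group G \<and> u \<in> carrier G \<rightarrow> carrier H \<and> v \<in> carrier G \<rightarrow> carrier \<Omega> \<and>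
     (\<forall>x\<in>carrier G. \<forall>y\<in>carrier G.
        u (x \<otimes>\<^bsub>G\<^esub> y) =
          u x \<otimes>\<^bsub>H\<^esub> (v x \<triangleright>\<^bsub>\<Omega>\<^esub> u y) \<otimes>\<^bsub>H\<^esub> cocycle \<Omega> (v x \<triangleleft>\<^bsub>\<Omega>\<^esub> u y) (v y) \<and>
        v (x \<otimes>\<^bsub>G\<^esub> y) = (v x \<triangleleft>\<^bsub>\<Omega>\<^esub> u y) \<otimes>\<^bsub>\<Omega>\<^esub> v y)}"

definition D_hom ::
    "('h, 's, 'a) D_triple \<Rightarrow> ('h, 's, 'b) D_triple \<Rightarrow> ('a \<Rightarrow> 'b) set" where
  "D_hom = (\<lambda>(G\<^sub>1, u\<^sub>1, v\<^sub>1) (G\<^sub>2, u\<^sub>2, v\<^sub>2).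
     {g \<in> hom G\<^sub>1 G\<^sub>2 \<inter> extensional (carrier G\<^sub>1).
        (\<forall>x\<in>carrier G\<^sub>1. u\<^sub>2 (g x) = u\<^sub>1 x) \<and> (\<forall>x\<in>carrier G\<^sub>1. v\<^sub>2 (g x) = v\<^sub>1 x)})"

lemma C_hom_id:
  "(G, u, v) \<in> C_obj H \<Omega> \<Longrightarrow>
    restrict id (carrier G) \<in> C_hom H \<Omega> (G, u, v) (G, u, v)"
  by (auto simp: C_obj_def C_hom_def hom_def Pi_iff group.is_monoid monoid.m_closed)

lemma C_hom_comp:
  "\<lbrakk>(G\<^sub>1, u\<^sub>1, v\<^sub>1) \<in> C_obj H \<Omega>; g \<in> C_hom H \<Omega> (G\<^sub>1, u\<^sub>1, v\<^sub>1) (G\<^sub>2, u\<^sub>2, v\<^sub>2);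
    k \<in> C_hom H \<Omega> (G\<^sub>2, u\<^sub>2, v\<^sub>2) (G\<^sub>3, u\<^sub>3, v\<^sub>3)\<rbrakk> \<Longrightarrow>
    compose (carrier G\<^sub>1) k g \<in> C_hom H \<Omega> (G\<^sub>1, u\<^sub>1, v\<^sub>1) (G\<^sub>3, u\<^sub>3, v\<^sub>3)"
  by (auto simp: C_obj_def C_hom_def hom_def Pi_iff compose_def group.is_monoid monoid.m_closed)

lemma D_hom_id:
  "(G, u, v) \<in> D_obj H \<Omega> \<Longrightarrow> restrict id (carrier G) \<in> D_hom (G, u, v) (G, u, v)"
  by (auto simp: D_obj_def D_hom_def hom_def Pi_iff group.is_monoid monoid.m_closed)

lemma D_hom_comp:
  "\<lbrakk>(G\<^sub>1, u\<^sub>1, v\<^sub>1) \<in> D_obj H \<Omega>; g \<in> D_hom (G\<^sub>1, u\<^sub>1, v\<^sub>1) (G\<^sub>2, u\<^sub>2, v\<^sub>2);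
    k \<in> D_hom (G\<^sub>2, u\<^sub>2, v\<^sub>2) (G\<^sub>3, u\<^sub>3, v\<^sub>3)\<rbrakk> \<Longrightarrow>
    compose (carrier G\<^sub>1) k g \<in> D_hom (G\<^sub>1, u\<^sub>1, v\<^sub>1) (G\<^sub>3, u\<^sub>3, v\<^sub>3)"
  by (auto simp: D_obj_def D_hom_def hom_def Pi_iff compose_def group.is_monoid monoid.m_closed)

text \<open>
  HOL cannot quantify over types inside a formula, so the element type \<open>'g\<close> of the test groups
  is an explicit parameter, independent of the element type of the candidate object.  A statement
  with \<open>'g\<close> a free type variable ranges over test groups on arbitrary types.
\<close>

definition C_initial ::
    "'g itself \<Rightarrow> ('h, 'm) monoid_scheme \<Rightarrow> ('h, 's) ext_system \<Rightarrow>
     ('h, 's, 'a) C_triple \<Rightarrow> bool" where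
  "C_initial _ H \<Omega> X \<longleftrightarrow> X \<in> C_obj H \<Omega> \<and>
     (\<forall>Y \<in> (C_obj H \<Omega> :: ('h, 's, 'g) C_triple set). \<exists>!g. g \<in> C_hom H \<Omega> X Y)"

definition D_final ::
    "'g itself \<Rightarrow> ('h, 'm) monoid_scheme \<Rightarrow> ('h, 's) ext_system \<Rightarrow>
     ('h, 's, 'a) D_triple \<Rightarrow> bool" where
  "D_final _ H \<Omega> X \<longleftrightarrow> X \<in> D_obj H \<Omega> \<and>
     (\<forall>Y \<in> (D_obj H \<Omega> :: ('h, 's, 'g) D_triple set). \<exists>!g. g \<in> D_hom Y X)"

end

theory Submission
  imports Defs
begin

text \<open>
  Every element of the unified product factors as
  \<open>(h, s) = (h, 1\<^sub>S) \<cdot> (1\<^sub>H, s)\<close>.  Hence a morphism out of it is determined by its values on the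
  two inclusions, and the only candidate for a target \<open>(G, (u, v))\<close> is \<open>(h, s) \<mapsto> u h \<cdot> v s\<close>.
  The two compatibility conditions on \<open>(u, v)\<close> are what is required for this candidate to be
  multiplicative: in \<open>u h\<^sub>1 \<cdot> v s\<^sub>1 \<cdot> u h\<^sub>2 \<cdot> v s\<^sub>2\<close> the second condition moves \<open>v s\<^sub>1\<close> past
  \<open>u h\<^sub>2\<close>, the first then merges the two adjacent values of \<open>v\<close>, and the result is the image of
  the product.  This candidate restricts to \<open>u\<close> on \<open>H\<close> because \<open>v 1\<^sub>S\<close> is an idempotent of
  the group \<open>G\<close>, thus trivial.

  Dually, an element of the unified product is determined by its two coordinates, so the only
  candidate for a morphism from \<open>(G, (u, v))\<close> is \<open>x \<mapsto> (u x, v x)\<close>.  The conditions on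
  \<open>(u, v)\<close> are, coordinate by coordinate, its multiplicativity.
\<close>

lemma carrier_unified_product [simp]:
  "carrier (unified_product H \<Omega>) = carrier H \<times> carrier \<Omega>"
  by (simp add: unified_product_def)

lemma mult_unified_product [simp]:
  "(h\<^sub>1, s\<^sub>1) \<otimes>\<^bsub>unified_product H \<Omega>\<^esub> (h\<^sub>2, s\<^sub>2) =
    (h\<^sub>1 \<otimes>\<^bsub>H\<^esub> (s\<^sub>1 \<triangleright>\<^bsub>\<Omega>\<^esub> h\<^sub>2) \<otimes>\<^bsub>H\<^esub> cocycle \<Omega> (s\<^sub>1 \<triangleleft>\<^bsub>\<Omega>\<^esub> h\<^sub>2) s\<^sub>2,
     (s\<^sub>1 \<triangleleft>\<^bsub>\<Omega>\<^esub> h\<^sub>2) \<otimes>\<^bsub>\<Omega>\<^esub> s\<^sub>2)"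
  by (simp add: unified_product_def)

context extending_datum
begin

text \<open>
  This factorisation gives uniqueness of morphisms out of the unified product.  It also rewrites
  the right-hand sides of the two compatibility conditions for the inclusions as plain pairs.
\<close>

lemma unified_product_factorisation:
  assumes "h \<in> carrier H" "s \<in> carrier \<Omega>"
  shows "(h, \<one>\<^bsub>\<Omega>\<^esub>) \<otimes>\<^bsub>unified_product H \<Omega>\<^esub> (\<one>, s) = (h, s)"
  using assms by (simp add: base_closed base_ract base_lact base_cocycle base_star)

lemma inclusions_in_C_obj:
  assumes "group (unified_product H \<Omega>)"
  shows "(unified_product H \<Omega>, (\<lambda>h. (h, \<one>\<^bsub>\<Omega>\<^esub>)), (\<lambda>s. (\<one>, s))) \<in> C_obj H \<Omega>"
  using assms
  by (auto simp: C_obj_def hom_def unified_product_factorisation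
      base_closed star_closed lact_closed ract_closed cocycle_closed
      star_base base_star lact_one base_lact base_ract ract_one cocycle_base base_cocycle)

lemma projections_in_D_obj:
  assumes "group (unified_product H \<Omega>)"
  shows "(unified_product H \<Omega>, fst, snd) \<in> D_obj H \<Omega>"
  using assms by (auto simp: D_obj_def)

text \<open>
  By the normalisation of \<open>\<ast>\<close> and \<open>f\<close>, the compatibility condition at \<open>(1\<^sub>S, 1\<^sub>S)\<close> says that
  \<open>v 1\<^sub>S\<close> is idempotent.
\<close>

lemma C_obj_base:
  assumes "(G, u, v) \<in> C_obj H \<Omega>"
  shows "v \<one>\<^bsub>\<Omega>\<^esub> = \<one>\<^bsub>G\<^esub>"
proof -
  from assms interpret G: group G by (simp add: C_obj_def)
  from assms have u: "u \<in> hom H G" and v: "v \<one>\<^bsub>\<Omega>\<^esub> \<in> carrier G"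
    using base_closed by (auto simp: C_obj_def)
  have "v \<one>\<^bsub>\<Omega>\<^esub> \<otimes>\<^bsub>G\<^esub> v \<one>\<^bsub>\<Omega>\<^esub> = u \<one> \<otimes>\<^bsub>G\<^esub> v \<one>\<^bsub>\<Omega>\<^esub>"
    using assms base_closed by (simp add: C_obj_def cocycle_base star_base)
  then have "v \<one>\<^bsub>\<Omega>\<^esub> \<otimes>\<^bsub>G\<^esub> v \<one>\<^bsub>\<Omega>\<^esub> = v \<one>\<^bsub>\<Omega>\<^esub>"
    using hom_one[OF u is_group G.is_group] v by simp
  then show ?thesis
    using v by simp
qed

text \<open>
  The image of a product contains the factors \<open>u (f \<dots>)\<close> and \<open>v (\<dots> \<ast> \<dots>)\<close>, which the first
  condition splits into two values of \<open>v\<close>; after that the factors \<open>u (s\<^sub>1 \<triangleright> h\<^sub>2)\<close> and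
  \<open>v (s\<^sub>1 \<triangleleft> h\<^sub>2)\<close> are adjacent, and the second condition applies.
\<close>

lemma C_obj_induced_hom:
  assumes "(G, u, v) \<in> C_obj H \<Omega>"
  shows "(\<lambda>(h, s). u h \<otimes>\<^bsub>G\<^esub> v s) \<in> hom (unified_product H \<Omega>) G"
proof -
  from assms interpret G: group G by (simp add: C_obj_def)
  from assms have u: "u \<in> hom H G" and v: "v \<in> carrier \<Omega> \<rightarrow> carrier G"
    and vv: "\<And>s t. \<lbrakk>s \<in> carrier \<Omega>; t \<in> carrier \<Omega>\<rbrakk> \<Longrightarrow>
      u (cocycle \<Omega> s t) \<otimes>\<^bsub>G\<^esub> v (s \<otimes>\<^bsub>\<Omega>\<^esub> t) = v s \<otimes>\<^bsub>G\<^esub> v t"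
    and vu: "\<And>s h. \<lbrakk>s \<in> carrier \<Omega>; h \<in> carrier H\<rbrakk> \<Longrightarrow>
      u (s \<triangleright>\<^bsub>\<Omega>\<^esub> h) \<otimes>\<^bsub>G\<^esub> v (s \<triangleleft>\<^bsub>\<Omega>\<^esub> h) = v s \<otimes>\<^bsub>G\<^esub> u h"
    by (auto simp: C_obj_def)
  have uc: "u h \<in> carrier G" if "h \<in> carrier H" for h
    using u that by (rule hom_in_carrier)
  have vc: "v s \<in> carrier G" if "s \<in> carrier \<Omega>" for s
    using v that by auto
  note closed = uc vc star_closed lact_closed ract_closed cocycle_closed
  have "u (h\<^sub>1 \<otimes> (s\<^sub>1 \<triangleright>\<^bsub>\<Omega>\<^esub> h\<^sub>2) \<otimes> cocycle \<Omega> (s\<^sub>1 \<triangleleft>\<^bsub>\<Omega>\<^esub> h\<^sub>2) s\<^sub>2)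
        \<otimes>\<^bsub>G\<^esub> v ((s\<^sub>1 \<triangleleft>\<^bsub>\<Omega>\<^esub> h\<^sub>2) \<otimes>\<^bsub>\<Omega>\<^esub> s\<^sub>2)
      = (u h\<^sub>1 \<otimes>\<^bsub>G\<^esub> v s\<^sub>1) \<otimes>\<^bsub>G\<^esub> (u h\<^sub>2 \<otimes>\<^bsub>G\<^esub> v s\<^sub>2)"
    if h: "h\<^sub>1 \<in> carrier H" "h\<^sub>2 \<in> carrier H" and s: "s\<^sub>1 \<in> carrier \<Omega>" "s\<^sub>2 \<in> carrier \<Omega>"
    for h\<^sub>1 h\<^sub>2 s\<^sub>1 s\<^sub>2
  proof -
    let ?r = "s\<^sub>1 \<triangleright>\<^bsub>\<Omega>\<^esub> h\<^sub>2" and ?l = "s\<^sub>1 \<triangleleft>\<^bsub>\<Omega>\<^esub> h\<^sub>2"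
    have "u (h\<^sub>1 \<otimes> ?r \<otimes> cocycle \<Omega> ?l s\<^sub>2) \<otimes>\<^bsub>G\<^esub> v (?l \<otimes>\<^bsub>\<Omega>\<^esub> s\<^sub>2)
        = u h\<^sub>1 \<otimes>\<^bsub>G\<^esub> u ?r \<otimes>\<^bsub>G\<^esub> (u (cocycle \<Omega> ?l s\<^sub>2) \<otimes>\<^bsub>G\<^esub> v (?l \<otimes>\<^bsub>\<Omega>\<^esub> s\<^sub>2))"
      using h s by (simp add: hom_mult[OF u] G.m_assoc closed)
    also have "\<dots> = u h\<^sub>1 \<otimes>\<^bsub>G\<^esub> u ?r \<otimes>\<^bsub>G\<^esub> (v ?l \<otimes>\<^bsub>G\<^esub> v s\<^sub>2)"
      using h s by (simp add: vv closed)
    also have "\<dots> = u h\<^sub>1 \<otimes>\<^bsub>G\<^esub> (u ?r \<otimes>\<^bsub>G\<^esub> v ?l) \<otimes>\<^bsub>G\<^esub> v s\<^sub>2"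
      using h s by (simp add: G.m_assoc closed)
    also have "\<dots> = (u h\<^sub>1 \<otimes>\<^bsub>G\<^esub> v s\<^sub>1) \<otimes>\<^bsub>G\<^esub> (u h\<^sub>2 \<otimes>\<^bsub>G\<^esub> v s\<^sub>2)"
      using h s by (simp add: vu G.m_assoc closed)
    finally show ?thesis .
  qed
  then show ?thesis
    by (auto simp: hom_def closed)
qed

lemma C_obj_ex1_hom:
  assumes "(G, u, v) \<in> C_obj H \<Omega>"
  shows "\<exists>!g. g \<in> C_hom H \<Omega>
    (unified_product H \<Omega>, (\<lambda>h. (h, \<one>\<^bsub>\<Omega>\<^esub>)), (\<lambda>s. (\<one>, s))) (G, u, v)"
proof (rule ex1I)
  let ?U = "unified_product H \<Omega>"
  let ?g = "\<lambda>(h, s). u h \<otimes>\<^bsub>G\<^esub> v s"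
  from assms interpret G: group G by (simp add: C_obj_def)
  from assms have u: "u \<in> hom H G" and v: "v \<in> carrier \<Omega> \<rightarrow> carrier G"
    by (auto simp: C_obj_def)
  have "?g \<in> hom ?U G"
    using assms by (rule C_obj_induced_hom)
  then have "restrict ?g (carrier ?U) \<in> hom ?U G"
    by (auto simp: hom_def Pi_iff star_closed lact_closed ract_closed cocycle_closed)
  moreover have "u h \<otimes>\<^bsub>G\<^esub> v \<one>\<^bsub>\<Omega>\<^esub> = u h" if "h \<in> carrier H" for h
    using hom_in_carrier[OF u that] by (simp add: C_obj_base[OF assms])
  moreover have "u \<one> \<otimes>\<^bsub>G\<^esub> v s = v s" if "s \<in> carrier \<Omega>" for s
    using funcset_mem[OF v that] hom_one[OF u is_group G.is_group] by simp
  ultimately show "restrict ?g (carrier ?U)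
      \<in> C_hom H \<Omega> (?U, (\<lambda>h. (h, \<one>\<^bsub>\<Omega>\<^esub>)), (\<lambda>s. (\<one>, s))) (G, u, v)"
    by (simp add: C_hom_def base_closed)
  fix k
  assume "k \<in> C_hom H \<Omega> (?U, (\<lambda>h. (h, \<one>\<^bsub>\<Omega>\<^esub>)), (\<lambda>s. (\<one>, s))) (G, u, v)"
  then have k: "k \<in> hom ?U G" and ext: "k \<in> extensional (carrier ?U)"
    and ku: "\<And>h. h \<in> carrier H \<Longrightarrow> k (h, \<one>\<^bsub>\<Omega>\<^esub>) = u h"
    and kv: "\<And>s. s \<in> carrier \<Omega> \<Longrightarrow> k (\<one>, s) = v s"
    by (auto simp: C_hom_def)
  have "k (h, s) = u h \<otimes>\<^bsub>G\<^esub> v s" if "h \<in> carrier H" "s \<in> carrier \<Omega>" for h s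
  proof -
    have "k (h, s) = k ((h, \<one>\<^bsub>\<Omega>\<^esub>) \<otimes>\<^bsub>?U\<^esub> (\<one>, s))"
      by (simp only: unified_product_factorisation[OF that])
    also have "\<dots> = k (h, \<one>\<^bsub>\<Omega>\<^esub>) \<otimes>\<^bsub>G\<^esub> k (\<one>, s)"
      using that by (intro hom_mult[OF k]) (simp_all add: base_closed)
    finally show ?thesis
      using that by (simp add: ku kv)
  qed
  then show "k = restrict ?g (carrier ?U)"
    by (intro extensionalityI[OF ext]) auto
qed

lemma D_obj_ex1_hom:
  assumes "(G, u, v) \<in> D_obj H \<Omega>"
  shows "\<exists>!g. g \<in> D_hom (G, u, v) (unified_product H \<Omega>, fst, snd)"
proof (rule ex1I)
  from assms interpret G: group G by (simp add: D_obj_def)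
  show "restrict (\<lambda>x. (u x, v x)) (carrier G)
      \<in> D_hom (G, u, v) (unified_product H \<Omega>, fst, snd)"
    using assms by (auto simp: D_hom_def D_obj_def hom_def Pi_iff)
  fix k
  assume "k \<in> D_hom (G, u, v) (unified_product H \<Omega>, fst, snd)"
  then have "k \<in> extensional (carrier G)"
    and "\<And>x. x \<in> carrier G \<Longrightarrow> k x = (u x, v x)"
    by (auto simp: D_hom_def prod_eq_iff)
  then show "k = restrict (\<lambda>x. (u x, v x)) (carrier G)"
    by (intro extensionalityI) auto
qed

end

theorem theorem2p12:
  fixes H :: "('h, 'm) monoid_scheme" and \<Omega> :: "('h, 's) ext_system"
  assumes "group_extending_structure H \<Omega>"
  shows "C_initial TYPE('g) H \<Omega>
           (unified_product H \<Omega>, (\<lambda>h. (h, \<one>\<^bsub>\<Omega>\<^esub>)), (\<lambda>s. (\<one>\<^bsub>H\<^esub>, s)))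
       \<and> D_final TYPE('g) H \<Omega> (unified_product H \<Omega>, fst, snd)"
proof -
  interpret group_extending_structure H \<Omega> by (fact assms)
  show ?thesis
    unfolding C_initial_def D_final_def
    by (intro conjI ballI inclusions_in_C_obj projections_in_D_obj unified_product_group;
        simp only: split_paired_all C_obj_ex1_hom D_obj_ex1_hom)
qed

end
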